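(* For every integer $n\geq 3$, the Albertson index of the caterpillar tree $C(n,3)$ is $$\operatorname{irr}(C(n,3)) = 12n-4.$$
   Context: All graphs are finite, simple and undirected. For a graph $G$ with edge set $E(G)$, $d_G(v)$ denotes the degree of the vertex $v$. The Albertson index of $G$ is $\operatorname{irr}(G)=\sum_{uv\in E(G)}|d_G(u)-d_G(v)|$. For positive integers $n,m$, the caterpillar tree $C(n,m)$ is the tree consisting of a path $x_1x_2\cdots x_n$ on $n$ vertices (the main vertices) together with, for each $i=1,\dots,n$, exactly $m$ pendent vertices (leaves) adjacent to $x_i$, these leaves being distinct for distinct $i$. In particular, in $C(n,3)$ each of the $n$ path vertices has exactly three pendent vertices attached. *)

theory Defs
  imports Main
begin

text \<open>A graph is a pair \<open>(V, E)\<close> of a vertex set and a set of edges, an (unordered) edge \<open>uv\<close>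
  being the two-element set \<open>{u, v}\<close>.\<close>

type_synonym 'a ugraph = "'a set \<times> 'a set set"

abbreviation verts :: "'a ugraph \<Rightarrow> 'a set" where
  "verts G \<equiv> fst G"

abbreviation edges :: "'a ugraph \<Rightarrow> 'a set set" where
  "edges G \<equiv> snd G"

definition finite_simple_graph :: "'a ugraph \<Rightarrow> bool" where
  "finite_simple_graph G \<longleftrightarrow>
     finite (verts G) \<and> (\<forall>e \<in> edges G. e \<subseteq> verts G \<and> card e = 2)"

definition degree :: "'a ugraph \<Rightarrow> 'a \<Rightarrow> nat" where
  "degree G v = card {u \<in> verts G. {v, u} \<in> edges G}"

text \<open>The definite description is well defined on two-element sets because the absolute value is
  symmetric in \<open>u\<close> and \<open>v\<close>; see \<open>imbalance_doubleton\<close>.\<close>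

definition imbalance :: "'a ugraph \<Rightarrow> 'a set \<Rightarrow> int" where
  "imbalance G e =
     (THE k. \<exists>u v. e = {u, v} \<and> k = \<bar>int (degree G u) - int (degree G v)\<bar>)"

lemma imbalance_doubleton:
  "imbalance G {u, v} = \<bar>int (degree G u) - int (degree G v)\<bar>"
  unfolding imbalance_def by (rule the_equality) (auto simp: doubleton_eq_iff)

definition albertson_index :: "'a ugraph \<Rightarrow> int" where
  "albertson_index G = (\<Sum>e \<in> edges G. imbalance G e)"

text \<open>\<open>Main_vertex i\<close> is $x_i$ and \<open>Leaf i j\<close> is the \<open>j\<close>-th pendent vertex attached to it.\<close>

datatype caterpillar_vertex = Main_vertex nat | Leaf nat nat

definition caterpillar :: "nat \<Rightarrow> nat \<Rightarrow> caterpillar_vertex ugraph" where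
  "caterpillar n m =
     ({Main_vertex i |i. i \<in> {1..n}} \<union> {Leaf i j |i j. i \<in> {1..n} \<and> j \<in> {1..m}},
      {{Main_vertex i, Main_vertex (i + 1)} |i. i \<in> {1..<n}} \<union>
      {{Main_vertex i, Leaf i j} |i j. i \<in> {1..n} \<and> j \<in> {1..m}})"

lemma finite_simple_graph_caterpillar: "finite_simple_graph (caterpillar n m)"
proof -
  have "{Leaf i j |i j. i \<in> {1..n} \<and> j \<in> {1..m}} = (\<lambda>(i, j). Leaf i j) ` ({1..n} \<times> {1..m})"
    by auto
  then have "finite {Leaf i j |i j. i \<in> {1..n} \<and> j \<in> {1..m}}"
    by simp
  then show ?thesis
    by (auto simp: finite_simple_graph_def caterpillar_def)
qed

end

theory Submission
  imports Defs
begin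

text \<open>In C(n,m) a leaf has degree 1, the two path ends have degree m+1 and every inner path
  vertex has degree m+2. So among the path edges only the first and the last are unbalanced, by 1
  each; they are distinct because n \<ge> 3. The m leaf edges at a path end contribute m each, those
  at an inner vertex m+1 each. The total is 2 + 2m^2 + (n-2)m(m+1) = nm(m+1) - 2m + 2, and m = 3
  gives 12n - 4. The degrees come from \<open>degree_caterpillar_Main_vertex\<close> and
  \<open>degree_caterpillar_Leaf\<close>; \<open>albertson_index_caterpillar_eq_sum\<close> turns
  the sum over edges into sums over indices.\<close>

lemma degree_caterpillar_Main_vertex:
  assumes "i \<in> {1..n}"
  shows "degree (caterpillar n m) (Main_vertex i) =
    m + (if i = 1 then 0 else 1) + (if i = n then 0 else 1)"
proof -
  \<comment> \<open>Indices of the path neighbours: the predecessor is missing at \<open>1\<close>,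
    the successor at \<open>n\<close>. If \<open>n = 1\<close>, both are missing.\<close>
  let ?P = "(if i = 1 then {} else {i - 1}) \<union> (if i = n then {} else {i + 1})"
  have nbrs: "{u \<in> verts (caterpillar n m). {Main_vertex i, u} \<in> edges (caterpillar n m)} =
      Main_vertex ` ?P \<union> Leaf i ` {1..m}" (is "?L = ?R")
  proof (rule set_eqI)
    fix u
    show "u \<in> ?L \<longleftrightarrow> u \<in> ?R"
    proof (cases u)
      case (Main_vertex k)
      have "u \<in> ?L \<longleftrightarrow> k \<in> {1..n} \<and> (k = i + 1 \<or> i = k + 1)"
        using assms by (auto simp: Main_vertex caterpillar_def doubleton_eq_iff)
      also have "\<dots> \<longleftrightarrow> k \<in> ?P"
        using assms by auto
      also have "\<dots> \<longleftrightarrow> u \<in> ?R"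
        by (auto simp: Main_vertex)
      finally show ?thesis .
    next
      case (Leaf k j)
      then show ?thesis
        using assms by (auto simp: caterpillar_def doubleton_eq_iff)
    qed
  qed
  have "card ?R = card (Main_vertex ` ?P) + card (Leaf i ` {1..m})"
    by (rule card_Un_disjoint) auto
  also have "card (Leaf i ` {1..m}) = m"
    by (simp add: card_image inj_on_def)
  also have "card (Main_vertex ` ?P) = card ?P"
    by (simp add: card_image inj_on_def)
  finally show ?thesis
    unfolding degree_def nbrs by auto
qed

lemma degree_caterpillar_Leaf:
  assumes "i \<in> {1..n}" "j \<in> {1..m}"
  shows "degree (caterpillar n m) (Leaf i j) = 1"
proof -
  have "{u \<in> verts (caterpillar n m). {Leaf i j, u} \<in> edges (caterpillar n m)} = {Main_vertex i}"
    using assms by (auto simp: caterpillar_def doubleton_eq_iff)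
  then show ?thesis
    by (simp add: degree_def)
qed

text \<open>Path edges and leaf edges are disjoint families, each indexed injectively, so every edge
  is counted exactly once. The \<open>1\<close> in the second sum is the degree of a leaf.\<close>

lemma albertson_index_caterpillar_eq_sum:
  fixes n m :: nat
  defines "d \<equiv> \<lambda>i. int (degree (caterpillar n m) (Main_vertex i))"
  shows "albertson_index (caterpillar n m) =
    (\<Sum>i = 1..<n. \<bar>d i - d (i + 1)\<bar>) + (\<Sum>i = 1..n. int m * \<bar>d i - 1\<bar>)"
proof -
  let ?G = "caterpillar n m"
  let ?p = "\<lambda>i. {Main_vertex i, Main_vertex (i + 1)}"
  let ?l = "\<lambda>(i, j). {Main_vertex i, Leaf i j}"
  have edges: "edges ?G = ?p ` {1..<n} \<union> ?l ` ({1..n} \<times> {1..m})"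
    by (auto simp: caterpillar_def)
  \<comment> \<open>Equal path edges with indices i and k cannot match crosswise: that would need i
    = k + 1 and k = i + 1.\<close>
  have inj_p: "inj_on ?p {1..<n}" and inj_l: "inj_on ?l ({1..n} \<times> {1..m})"
    by (auto simp: inj_on_def doubleton_eq_iff)
  have "albertson_index ?G =
      sum (imbalance ?G) (?p ` {1..<n}) + sum (imbalance ?G) (?l ` ({1..n} \<times> {1..m}))"
    unfolding albertson_index_def edges
    by (rule sum.union_disjoint) (auto simp: doubleton_eq_iff)
  also have "sum (imbalance ?G) (?p ` {1..<n}) = (\<Sum>i = 1..<n. \<bar>d i - d (i + 1)\<bar>)"
    unfolding sum.reindex[OF inj_p] by (simp add: imbalance_doubleton d_def)
  also have "sum (imbalance ?G) (?l ` ({1..n} \<times> {1..m})) =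
      (\<Sum>(i, j) \<in> {1..n} \<times> {1..m}. \<bar>d i - 1\<bar>)"
    unfolding sum.reindex[OF inj_l]
    by (rule sum.cong) (auto simp: imbalance_doubleton degree_caterpillar_Leaf d_def)
  also have "\<dots> = (\<Sum>i = 1..n. int m * \<bar>d i - 1\<bar>)"
    by (simp flip: sum.cartesian_product)
  finally show ?thesis .
qed

lemma albertson_index_caterpillar:
  assumes "n \<ge> 3"
  shows "albertson_index (caterpillar n m) = int n * int m * (int m + 1) - 2 * int m + 2"
proof -
  define d where "d i = int (degree (caterpillar n m) (Main_vertex i))" for i
  have d_end: "d 1 = int m + 1" "d n = int m + 1"
    using assms by (auto simp: d_def degree_caterpillar_Main_vertex)
  have d_inner: "d i = int m + 2" if "i \<in> {2..n - 1}" for i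
    using assms that by (auto simp: d_def degree_caterpillar_Main_vertex)
  \<comment> \<open>The edge with index i joins positions i and i + 1, so the end edges are
    \<open>1\<close> and \<open>n - 1\<close>, whereas the end vertices are \<open>1\<close> and
    \<open>n\<close>.\<close>
  have path: "{1..<n} = {1, n - 1} \<union> {2..<n - 1}" and spine: "{1..n} = {1, n} \<union> {2..n - 1}"
    using assms by auto
  have "(\<Sum>i = 1..<n. \<bar>d i - d (i + 1)\<bar>) =
      (\<Sum>i \<in> {1, n - 1}. \<bar>d i - d (i + 1)\<bar>) + (\<Sum>i = 2..<n - 1. \<bar>d i - d (i + 1)\<bar>)"
    unfolding path by (rule sum.union_disjoint) auto
  also have "(\<Sum>i = 2..<n - 1. \<bar>d i - d (i + 1)\<bar>) = 0"
    by (rule sum.neutral) (auto simp: d_inner)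
  \<comment> \<open>Since n \<ge> 3, the indices \<open>1\<close> and \<open>n - 1\<close> differ,
    and the positions \<open>2\<close> and \<open>n - 1\<close> are inner; each end edge thus gives
    |(m+1) - (m+2)| = 1.\<close>
  also have "(\<Sum>i \<in> {1, n - 1}. \<bar>d i - d (i + 1)\<bar>) = 2"
    using assms d_end d_inner[of 2] d_inner[of "n - 1"] by (simp add: numeral_2_eq_2)
  finally have path_sum: "(\<Sum>i = 1..<n. \<bar>d i - d (i + 1)\<bar>) = 2" by simp
  have "(\<Sum>i = 1..n. int m * \<bar>d i - 1\<bar>) =
      (\<Sum>i \<in> {1, n}. int m * \<bar>d i - 1\<bar>) + (\<Sum>i = 2..n - 1. int m * \<bar>d i - 1\<bar>)"
    unfolding spine using assms by (intro sum.union_disjoint) auto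
  also have "(\<Sum>i = 2..n - 1. int m * \<bar>d i - 1\<bar>) = (\<Sum>i = 2..n - 1. int m * (int m + 1))"
    by (rule sum.cong) (auto simp: d_inner)
  \<comment> \<open>There are n - 2 inner vertices; n \<ge> 3 makes the truncated subtraction agree
    with the integer one.\<close>
  also have "\<dots> = (int n - 2) * (int m * (int m + 1))"
    using assms by (simp add: of_nat_diff)
  also have "(\<Sum>i \<in> {1, n}. int m * \<bar>d i - 1\<bar>) = 2 * (int m * int m)"
    using assms d_end by simp
  finally have "(\<Sum>i = 1..n. int m * \<bar>d i - 1\<bar>) =
      2 * (int m * int m) + (int n - 2) * (int m * (int m + 1))" .
  with path_sum show ?thesis
    unfolding albertson_index_caterpillar_eq_sum d_def[symmetric]
    by (simp add: algebra_simps)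
qed

theorem proposition3p1:
  fixes n :: nat
  assumes "n \<ge> 3"
  shows "albertson_index (caterpillar n 3) = 12 * int n - 4"
  using assms by (simp add: albertson_index_caterpillar)

end
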